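(* Let $t\geq 2$ and let $a_3,a_4,\dots,a_{2t}\geq 0$ be integers. Let $G$ be the disjoint union of $a_i$ copies of the cycle $C_i$ for each $i\in\{3,\dots,2t\}$, and let $n=\sum_{i=3}^{2t} i\,a_i$ be its order; assume $n\geq 6$. (1) If $n$ is even and $a_5+a_7+\dots+a_{2t-1}=a_3$, then $G^c$ is an extremal $(r|\chi)$-graph (for its own regularity $r$ and chromatic number $\chi$). (2) If $n$ is odd and $a_5+a_7+\dots+a_{2t-1}=a_3+1$, then $G^c$ is an extremal $(r|\chi)$-graph (for its own regularity $r$ and chromatic number $\chi$).
   Context: An $(r|\chi)$-graph is a simple finite $r$-regular graph with chromatic number $\chi$; it is extremal if it has the minimum possible order among all $(r|\chi)$-graphs. $G^c$ denotes the complement of $G$; it is $(n-3)$-regular. *)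

theory Defs
  imports Main
begin

type_synonym 'a ugraph = "'a set \<times> 'a set set"

abbreviation verts :: "'a ugraph \<Rightarrow> 'a set" where
  "verts G \<equiv> fst G"

abbreviation edges :: "'a ugraph \<Rightarrow> 'a set set" where
  "edges G \<equiv> snd G"

definition all_pairs :: "'a set \<Rightarrow> 'a set set" where
  "all_pairs V = {e. e \<subseteq> V \<and> card e = 2}"

definition simple_finite_graph :: "'a ugraph \<Rightarrow> bool" where
  "simple_finite_graph G \<longleftrightarrow> finite (verts G) \<and> edges G \<subseteq> all_pairs (verts G)"

definition degree :: "'a ugraph \<Rightarrow> 'a \<Rightarrow> nat" where
  "degree G v = card {e \<in> edges G. v \<in> e}"

definition regular :: "nat \<Rightarrow> 'a ugraph \<Rightarrow> bool" where
  "regular r G \<longleftrightarrow> (\<forall>v \<in> verts G. degree G v = r)"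

definition proper_colouring :: "'a ugraph \<Rightarrow> nat \<Rightarrow> ('a \<Rightarrow> nat) \<Rightarrow> bool" where
  "proper_colouring G k c \<longleftrightarrow>
     c ` verts G \<subseteq> {..<k} \<and>
     (\<forall>u \<in> verts G. \<forall>v \<in> verts G. {u, v} \<in> edges G \<longrightarrow> c u \<noteq> c v)"

definition chromatic_number :: "'a ugraph \<Rightarrow> nat" where
  "chromatic_number G = (LEAST k. \<exists>c. proper_colouring G k c)"

definition complement :: "'a ugraph \<Rightarrow> 'a ugraph" where
  "complement G = (verts G, all_pairs (verts G) - edges G)"

definition r_chi_graph :: "nat \<Rightarrow> nat \<Rightarrow> 'a ugraph \<Rightarrow> bool" where
  "r_chi_graph r \<chi> G \<longleftrightarrow>
     simple_finite_graph G \<and> regular r G \<and> chromatic_number G = \<chi>"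

text \<open>The competing graphs \<open>H\<close> range over graphs with vertices in \<^typ>\<open>nat\<close>. This is no
  restriction, since every finite graph has an isomorphic copy there; the lemma
  \<open>extremal_r_chi_graph_le\<close> below gives the comparison for an arbitrary vertex type.\<close>

definition extremal_r_chi_graph :: "nat \<Rightarrow> nat \<Rightarrow> 'a ugraph \<Rightarrow> bool" where
  "extremal_r_chi_graph r \<chi> G \<longleftrightarrow>
     r_chi_graph r \<chi> G \<and>
     (\<forall>H :: nat ugraph. r_chi_graph r \<chi> H \<longrightarrow> card (verts G) \<le> card (verts H))"

text \<open>This is the cycle of length \<open>n\<close> only for \<open>n \<ge> 3\<close>.\<close>

definition cycle_graph :: "nat \<Rightarrow> nat ugraph" where
  "cycle_graph n = ({..<n}, {{k, Suc k mod n} | k. k < n})"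

definition disjoint_union :: "'i set \<Rightarrow> ('i \<Rightarrow> 'a ugraph) \<Rightarrow> ('i \<times> 'a) ugraph" where
  "disjoint_union I H =
     (SIGMA i:I. verts (H i), {Pair i ` e | i e. i \<in> I \<and> e \<in> edges (H i)})"

text \<open>The component with index \<open>(i, j)\<close> is the \<open>j\<close>-th of the \<open>a i\<close> copies of the \<open>i\<close>-cycle.\<close>

definition cycles_union :: "nat \<Rightarrow> (nat \<Rightarrow> nat) \<Rightarrow> ((nat \<times> nat) \<times> nat) ugraph" where
  "cycles_union t a =
     disjoint_union (SIGMA i:{3..2 * t}. {..<a i}) (\<lambda>(i, j). cycle_graph i)"

lemma r_chi_graph_image:
  fixes G :: "'a ugraph" and f :: "'a \<Rightarrow> 'b"
  assumes G: "r_chi_graph r \<chi> G" and inj: "inj_on f (verts G)"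
  shows "r_chi_graph r \<chi> (f ` verts G, (\<lambda>e. f ` e) ` edges G)" (is "r_chi_graph r \<chi> ?H")
proof -
  have sub: "e \<subseteq> verts G" "card e = 2" if "e \<in> edges G" for e
    using G that by (auto simp: r_chi_graph_def simple_finite_graph_def all_pairs_def)
  have memE: "f u \<in> f ` e \<longleftrightarrow> u \<in> e" if "u \<in> verts G" "e \<in> edges G" for u e
    using inj_on_image_mem_iff[OF inj that(1) sub(1)[OF that(2)]] .
  have simple: "simple_finite_graph ?H"
    using G sub inj
    by (fastforce simp: r_chi_graph_def simple_finite_graph_def all_pairs_def
        card_image inj_on_subset)
  have injE: "inj_on (\<lambda>e. f ` e) (edges G)"
    using sub(1) inj by (meson inj_onI inj_on_image_eq_iff)
  have deg: "degree ?H (f v) = degree G v" if v: "v \<in> verts G" for v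
  proof -
    have "{e \<in> edges ?H. f v \<in> e} = (\<lambda>e. f ` e) ` {e \<in> edges G. v \<in> e}"
      using memE[OF v] by auto
    then show ?thesis
      unfolding degree_def
      using card_image[of "\<lambda>e. f ` e" "{e \<in> edges G. v \<in> e}"] injE
      by (simp add: inj_on_def)
  qed
  then have reg: "regular r ?H"
    using G by (auto simp: regular_def r_chi_graph_def)
  have edge: "{f u, f v} \<in> edges ?H \<longleftrightarrow> {u, v} \<in> edges G"
    if uv: "u \<in> verts G" "v \<in> verts G" for u v
  proof
    assume "{f u, f v} \<in> edges ?H"
    then obtain e where e: "e \<in> edges G" "f ` {u, v} = f ` e" by auto
    then have "{u, v} = e"
      using inj_on_image_eq_iff[OF inj, of "{u, v}" e] sub(1)[OF e(1)] uv by auto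
    with e show "{u, v} \<in> edges G" by simp
  next
    assume "{u, v} \<in> edges G"
    then have "f ` {u, v} \<in> edges ?H" by (simp only: snd_conv imageI)
    then show "{f u, f v} \<in> edges ?H" by simp
  qed
  have "(\<exists>c. proper_colouring ?H k c) \<longleftrightarrow> (\<exists>c. proper_colouring G k c)" for k
  proof
    assume "\<exists>c. proper_colouring ?H k c"
    then obtain c where c: "proper_colouring ?H k c" ..
    have "proper_colouring G k (c \<circ> f)"
      using c edge by (simp add: proper_colouring_def image_subset_iff)
    then show "\<exists>c. proper_colouring G k c" by blast
  next
    assume "\<exists>c. proper_colouring G k c"
    then obtain c where c: "proper_colouring G k c" ..
    have "proper_colouring ?H k (c \<circ> inv_into (verts G) f)"
      using c edge inj by (simp add: proper_colouring_def image_subset_iff)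
    then show "\<exists>c. proper_colouring ?H k c" by blast
  qed
  then have "chromatic_number ?H = chromatic_number G"
    by (simp add: chromatic_number_def)
  with simple reg G show ?thesis by (simp add: r_chi_graph_def)
qed

lemma extremal_r_chi_graph_le:
  fixes G :: "'a ugraph" and H :: "'b ugraph"
  assumes "extremal_r_chi_graph r \<chi> G" and H: "r_chi_graph r \<chi> H"
  shows "card (verts G) \<le> card (verts H)"
proof -
  have "finite (verts H)"
    using H by (simp add: r_chi_graph_def simple_finite_graph_def)
  then obtain f :: "'b \<Rightarrow> nat" where f: "inj_on f (verts H)"
    using finite_imp_inj_to_nat_seg by blast
  have "card (verts G) \<le> card (f ` verts H)"
    using assms(1) r_chi_graph_image[OF H f] unfolding extremal_r_chi_graph_def by force
  then show ?thesis by (simp add: card_image f)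
qed

end

theory Submission imports Defs begin

text \<open>A colour class of \<open>G\<^sup>c\<close> is a clique of \<open>G\<close>, that is, a vertex, an edge or a whole triangle, so a
  triangle component needs one colour, a cycle of length \<open>i > 3\<close> needs \<open>\<lceil>i/2\<rceil>\<close> colours, and no
  colour is shared between components. The hypotheses therefore say exactly that the chromatic
  number of \<open>G\<^sup>c\<close> is \<open>\<lceil>n/2\<rceil>\<close>. A smaller \<open>(n - 3)\<close>-regular graph has \<open>n - 2\<close> or \<open>n - 1\<close> vertices.
  In the first case it is complete and its chromatic number \<open>n - 2\<close> is too large. In the second case
  its complement is a perfect matching, so that \<open>n\<close> is odd and \<open>(n - 1)/2\<close> colours suffice.\<close>

section \<open>Neighbours and colourings\<close>

definition nbrs :: "'a ugraph \<Rightarrow> 'a \<Rightarrow> 'a set" where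
  "nbrs G v = {u \<in> verts G. {v, u} \<in> edges G}"

lemma insert_in_all_pairs: "{v, u} \<in> all_pairs V \<longleftrightarrow> v \<in> V \<and> u \<in> V \<and> v \<noteq> u"
  by (auto simp: all_pairs_def card_insert_if)

lemma nbrs_subset:
  assumes "simple_finite_graph G"
  shows "nbrs G v \<subseteq> verts G - {v}"
  using assms insert_in_all_pairs[of v _ "verts G"]
  by (auto simp: nbrs_def simple_finite_graph_def)

text \<open>Each edge at \<open>v\<close> is determined by its other endpoint. Degrees thus become
  sizes of vertex sets, on which complementation is a set difference.\<close>

lemma degree_eq_card_nbrs:
  assumes "simple_finite_graph G"
  shows "degree G v = card (nbrs G v)"
proof -
  have E: "edges G \<subseteq> all_pairs (verts G)"
    using assms by (simp add: simple_finite_graph_def)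
  have "\<exists>u. e = {v, u}" if "card e = 2" "v \<in> e" for e
    using that by (auto simp: card_2_iff)
  then have "{e \<in> edges G. v \<in> e} = (\<lambda>u. {v, u}) ` nbrs G v"
    using E by (fastforce simp: nbrs_def all_pairs_def)
  moreover have "inj_on (\<lambda>u. {v, u}) (nbrs G v)"
    by (auto simp: inj_on_def doubleton_eq_iff)
  ultimately show ?thesis
    by (simp add: degree_def card_image)
qed

lemma simple_finite_graph_complement:
  "finite (verts G) \<Longrightarrow> simple_finite_graph (complement G)"
  by (auto simp: simple_finite_graph_def complement_def)

lemma verts_complement [simp]: "verts (complement G) = verts G"
  by (simp add: complement_def)

lemma edge_complement_iff:
  "{u, v} \<in> edges (complement G) \<longleftrightarrow>
     u \<in> verts G \<and> v \<in> verts G \<and> u \<noteq> v \<and> {u, v} \<notin> edges G"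
  by (auto simp: complement_def insert_in_all_pairs)

lemma degree_complement:
  assumes "simple_finite_graph G" "v \<in> verts G"
  shows "degree (complement G) v = card (verts G) - 1 - degree G v"
proof -
  have fin: "finite (verts G)"
    using assms(1) by (simp add: simple_finite_graph_def)
  have "nbrs (complement G) v = (verts G - {v}) - nbrs G v"
    using assms(2) by (auto simp: nbrs_def edge_complement_iff)
  then show ?thesis
    using assms fin nbrs_subset[OF assms(1), of v]
    by (simp add: degree_eq_card_nbrs simple_finite_graph_complement card_Diff_subset
        finite_subset)
qed

text \<open>Renumbering the colours in use along a bijection loses nothing. This allows later
  colourings to take sets or pairs as colours.\<close>

lemma proper_colouring_of_arbitrary_colours:
  assumes "finite (verts G)"
    and "\<And>u v. u \<in> verts G \<Longrightarrow> v \<in> verts G \<Longrightarrow> {u, v} \<in> edges G \<Longrightarrow> c u \<noteq> c v"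
  shows "\<exists>c'. proper_colouring G (card (c ` verts G)) c'"
proof -
  obtain h where h: "bij_betw h (c ` verts G) {0..<card (c ` verts G)}"
    using ex_bij_betw_finite_nat assms(1) by blast
  have "proper_colouring G (card (c ` verts G)) (h \<circ> c)"
    unfolding proper_colouring_def
  proof (intro conjI ballI impI)
    show "(h \<circ> c) ` verts G \<subseteq> {..<card (c ` verts G)}"
      using bij_betw_imp_surj_on[OF h] by auto
    show "(h \<circ> c) u \<noteq> (h \<circ> c) v" if "u \<in> verts G" "v \<in> verts G" "{u, v} \<in> edges G" for u v
      using assms(2)[OF that] that bij_betw_imp_inj_on[OF h] by (auto dest: inj_onD)
  qed
  then show ?thesis by blast
qed

lemma chromatic_number_le: "proper_colouring G k c \<Longrightarrow> chromatic_number G \<le> k"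
  unfolding chromatic_number_def by (rule Least_le) blast

lemma chromatic_number_le_card_image:
  assumes "finite (verts G)"
    and "\<And>u v. u \<in> verts G \<Longrightarrow> v \<in> verts G \<Longrightarrow> {u, v} \<in> edges G \<Longrightarrow> c u \<noteq> c v"
  shows "chromatic_number G \<le> card (c ` verts G)"
proof -
  obtain c' where "proper_colouring G (card (c ` verts G)) c'"
    using proper_colouring_of_arbitrary_colours[of G c] assms by blast
  then show ?thesis
    by (rule chromatic_number_le)
qed

lemma chromatic_number_attained:
  assumes "simple_finite_graph G"
  obtains c where "proper_colouring G (chromatic_number G) c"
proof -
  \<comment> \<open>Giving every vertex its own colour shows that some number of colours suffices,
    so the \<open>LEAST\<close> in \<open>chromatic_number\<close> is attained.\<close>
  have "\<exists>c. proper_colouring G (card (id ` verts G)) c"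
    using assms insert_in_all_pairs[of _ _ "verts G"]
    by (intro proper_colouring_of_arbitrary_colours) (auto simp: simple_finite_graph_def)
  then have "\<exists>c. proper_colouring G (chromatic_number G) c"
    unfolding chromatic_number_def by (rule LeastI)
  then show thesis
    using that by blast
qed

section \<open>Regular graphs of small codegree\<close>

lemma regular_less_card:
  assumes "simple_finite_graph H" "regular r H" "verts H \<noteq> {}"
  shows "r < card (verts H)"
proof -
  obtain v where v: "v \<in> verts H"
    using assms(3) by blast
  have fin: "finite (verts H)"
    using assms(1) by (simp add: simple_finite_graph_def)
  have "r = card (nbrs H v)"
    using assms v by (simp add: regular_def degree_eq_card_nbrs)
  also have "\<dots> < card (verts H)"
    using nbrs_subset[OF assms(1), of v] v fin by (intro psubset_card_mono) auto
  finally show ?thesis .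
qed

text \<open>Such a graph is complete: a neighbour set of size \<open>r\<close> fills all of
  \<open>verts H - {v}\<close>. Hence every proper colouring is injective.\<close>

lemma card_le_chromatic_number_complete:
  assumes H: "simple_finite_graph H" and reg: "regular r H" and card: "card (verts H) = r + 1"
  shows "card (verts H) \<le> chromatic_number H"
proof -
  have fin: "finite (verts H)"
    using H by (simp add: simple_finite_graph_def)
  have nb: "nbrs H v = verts H - {v}" if "v \<in> verts H" for v
  proof (rule card_subset_eq)
    show "card (nbrs H v) = card (verts H - {v})"
      using that reg card fin by (simp add: regular_def degree_eq_card_nbrs[OF H])
  qed (use fin nbrs_subset[OF H] in auto)
  obtain c where c: "proper_colouring H (chromatic_number H) c"
    using chromatic_number_attained[OF H] .
  have "inj_on c (verts H)"
  proof (rule inj_onI, rule ccontr)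
    fix u v assume uv: "u \<in> verts H" "v \<in> verts H" "c u = c v" "u \<noteq> v"
    then have "v \<in> nbrs H u"
      using nb by blast
    then have "{u, v} \<in> edges H"
      by (simp add: nbrs_def)
    with c uv show False
      unfolding proper_colouring_def by blast
  qed
  then have "card (verts H) = card (c ` verts H)"
    by (simp add: card_image)
  also have "\<dots> \<le> card {..<chromatic_number H}"
    using c by (intro card_mono) (auto simp: proper_colouring_def)
  finally show ?thesis by simp
qed

text \<open>Every vertex misses exactly one other vertex. The missing pairs form a perfect matching
  of the complement, and each of them is an independent set that can share one colour.\<close>

lemma cocktail_party:
  assumes H: "simple_finite_graph H" and reg: "regular r H" and card: "card (verts H) = r + 2"
  shows "even (card (verts H))" and "2 * chromatic_number H \<le> card (verts H)"
proof -
  have fin: "finite (verts H)"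
    using H by (simp add: simple_finite_graph_def)
  have "\<exists>u. verts H - {v} - nbrs H v = {u}" if "v \<in> verts H" for v
  proof -
    have "card (nbrs H v) = r"
      using that reg by (simp add: regular_def degree_eq_card_nbrs[OF H])
    then have "card (verts H - {v} - nbrs H v) = 1"
      using that card fin nbrs_subset[OF H, of v]
      by (simp add: card_Diff_subset finite_subset)
    then show ?thesis
      by (simp add: card_1_singleton_iff)
  qed
  then obtain p where p: "\<And>v. v \<in> verts H \<Longrightarrow> verts H - {v} - nbrs H v = {p v}"
    by metis
  have pV: "p v \<in> verts H" and pne: "p v \<noteq> v" and pE: "{v, p v} \<notin> edges H"
    if "v \<in> verts H" for v
    using p[OF that] by (auto simp: nbrs_def)
  have puniq: "u = p v" if "v \<in> verts H" "u \<in> verts H" "u \<noteq> v" "{v, u} \<notin> edges H" for u v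
    using p[OF that(1)] that by (auto simp: nbrs_def)
  \<comment> \<open>Non-adjacency is symmetric, so the unique non-neighbour map \<open>p\<close> is
    an involution; the sets \<open>{v, p v}\<close> therefore partition the vertices.\<close>
  have pp: "p (p v) = v" if "v \<in> verts H" for v
    using puniq[of "p v" v] pV[OF that] pne[OF that] pE[OF that] that
    by (simp add: insert_commute)
  let ?q = "\<lambda>v. {v, p v}"
  have disj: "A \<inter> B = {}" if "A \<in> ?q ` verts H" "B \<in> ?q ` verts H" "A \<noteq> B" for A B
  proof -
    obtain u v where uv: "u \<in> verts H" "v \<in> verts H" "A = ?q u" "B = ?q v"
      using \<open>A \<in> _\<close> \<open>B \<in> _\<close> by blast
    then have "u \<noteq> v" "u \<noteq> p v" "v \<noteq> p u"
      using \<open>A \<noteq> B\<close> pp by (auto simp: insert_commute)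
    moreover from this have "p u \<noteq> p v"
      using uv pp by metis
    ultimately show ?thesis
      using uv by auto
  qed
  have "2 * card (?q ` verts H) = card (\<Union> (?q ` verts H))"
  proof (rule card_partition)
    show "finite (\<Union> (?q ` verts H))"
      using fin by auto
    show "card A = 2" if "A \<in> ?q ` verts H" for A
      using that pne by (force simp: card_insert_if)
  qed (use fin disj in auto)
  moreover have "\<Union> (?q ` verts H) = verts H"
    using pV by auto
  ultimately have two: "2 * card (?q ` verts H) = card (verts H)"
    by simp
  then show "even (card (verts H))"
    by (metis dvd_triv_left)
  \<comment> \<open>The block \<open>{v, p v}\<close> itself serves as the colour of
    \<open>v\<close>.\<close>
  have "chromatic_number H \<le> card (?q ` verts H)"
  proof (rule chromatic_number_le_card_image[OF fin])
    fix u v assume uv: "u \<in> verts H" "v \<in> verts H" "{u, v} \<in> edges H"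
    have "u \<noteq> v"
      using uv H insert_in_all_pairs[of u v "verts H"] by (auto simp: simple_finite_graph_def)
    moreover have "v \<noteq> p u"
      using uv pE by blast
    ultimately show "?q u \<noteq> ?q v"
      by (auto simp: doubleton_eq_iff)
  qed
  with two show "2 * chromatic_number H \<le> card (verts H)"
    by simp
qed

section \<open>Disjoint unions of cycles\<close>

text \<open>Unfolding \<open>mod\<close> into explicit wrap-around cases leaves later adjacency
  questions to linear arithmetic.\<close>

lemma cycle_graph_edge_iff:
  assumes "x < n" "y < n"
  shows "{x, y} \<in> edges (cycle_graph n) \<longleftrightarrow>
    Suc x = y \<or> Suc y = x \<or> (x = 0 \<and> Suc y = n) \<or> (y = 0 \<and> Suc x = n)"
proof -
  have "{x, y} \<in> edges (cycle_graph n) \<longleftrightarrow> y = Suc x mod n \<or> x = Suc y mod n"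
    using assms by (auto simp: cycle_graph_def doubleton_eq_iff)
  moreover have "Suc z mod n = (if Suc z = n then 0 else Suc z)" if "z < n" for z
    using that by auto
  ultimately show ?thesis
    using assms by auto
qed

lemma simple_finite_cycle_graph:
  assumes "n \<ge> 3"
  shows "simple_finite_graph (cycle_graph n)"
proof -
  have "k \<noteq> Suc k mod n" if "k < n" for k
    using that assms by (cases "Suc k = n") auto
  then show ?thesis
    using assms
    by (auto simp: simple_finite_graph_def cycle_graph_def insert_in_all_pairs)
qed

lemma card_nbrs_cycle_graph:
  assumes "n \<ge> 3" "x < n"
  shows "card (nbrs (cycle_graph n) x) = 2"
proof -
  let ?s = "if Suc x = n then 0 else Suc x" and ?p = "if x = 0 then n - 1 else x - 1"
  have "nbrs (cycle_graph n) x = {y. y < n \<and> {x, y} \<in> edges (cycle_graph n)}"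
    by (auto simp: nbrs_def cycle_graph_def)
  also have "\<dots> = {?s, ?p}"
    using assms by (auto simp: cycle_graph_edge_iff)
  \<comment> \<open>The bound \<open>n \<ge> 3\<close> keeps successor and predecessor distinct,
    also where the cycle wraps around.\<close>
  finally show ?thesis
    using assms by (auto simp: card_insert_if)
qed

text \<open>Three pairwise adjacent vertices would close up a triangle, and a cycle of length at
  least 4 contains none.\<close>

lemma card_clique_cycle_graph:
  assumes "n \<ge> 4" "A \<subseteq> {..<n}"
    and clique: "\<And>x y. x \<in> A \<Longrightarrow> y \<in> A \<Longrightarrow> x \<noteq> y \<Longrightarrow> {x, y} \<in> edges (cycle_graph n)"
  shows "card A \<le> 2"
proof (rule ccontr)
  assume "\<not> card A \<le> 2"
  then obtain B where B: "B \<subseteq> A" "card B = 3"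
    using obtain_subset_with_card_n[of 3 A] by (auto simp: not_le)
  then obtain x y z where xyz: "B = {x, y, z}" "x \<noteq> y" "y \<noteq> z" "x \<noteq> z"
    by (auto simp: card_3_iff)
  have lt: "x < n" "y < n" "z < n"
    using B xyz assms(2) by auto
  have "{x, y} \<in> edges (cycle_graph n)" "{y, z} \<in> edges (cycle_graph n)"
    "{x, z} \<in> edges (cycle_graph n)"
    using clique B xyz by auto
  with lt xyz assms(1) show False
    unfolding cycle_graph_edge_iff[OF lt(1,2)] cycle_graph_edge_iff[OF lt(2,3)]
      cycle_graph_edge_iff[OF lt(1,3)]
    by arith
qed

text \<open>Pigeonhole count over the fibres of \<open>f\<close>; for a colouring the fibres are the
  colour classes.\<close>

lemma card_le_mult_card_image:
  assumes "finite A" and "\<And>b. b \<in> f ` A \<Longrightarrow> card {x \<in> A. f x = b} \<le> k"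
  shows "card A \<le> k * card (f ` A)"
proof -
  have "A = (\<Union>b\<in>f ` A. {x \<in> A. f x = b})"
    by auto
  then have "card A \<le> (\<Sum>b\<in>f ` A. card {x \<in> A. f x = b})"
    using card_UN_le[of "f ` A" "\<lambda>b. {x \<in> A. f x = b}"] assms(1) by simp
  also have "\<dots> \<le> card (f ` A) * k"
    using sum_bounded_above[of "f ` A" "\<lambda>b. card {x \<in> A. f x = b}" k] assms(2) by simp
  finally show ?thesis
    by (simp add: mult.commute)
qed

section \<open>Disjoint unions of arbitrary graphs\<close>

lemma disjoint_union_edge_iff:
  "{(i, x), (j, y)} \<in> edges (disjoint_union I H) \<longleftrightarrow>
     i = j \<and> i \<in> I \<and> {x, y} \<in> edges (H i)"
proof
  assume "{(i, x), (j, y)} \<in> edges (disjoint_union I H)"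
  then obtain k e where e: "k \<in> I" "e \<in> edges (H k)" "{(i, x), (j, y)} = Pair k ` e"
    by (auto simp: disjoint_union_def)
  then have "i = k" "j = k"
    by auto
  with e(3) have "Pair k ` {x, y} = Pair k ` e"
    by simp
  then have "{x, y} = e"
    using inj_image_eq_iff[of "Pair k" "{x, y}" e] by (simp add: inj_on_def)
  with e \<open>i = k\<close> \<open>j = k\<close> show "i = j \<and> i \<in> I \<and> {x, y} \<in> edges (H i)"
    by simp
next
  assume r: "i = j \<and> i \<in> I \<and> {x, y} \<in> edges (H i)"
  then have "{(i, x), (j, y)} = Pair i ` {x, y}"
    by simp
  with r show "{(i, x), (j, y)} \<in> edges (disjoint_union I H)"
    unfolding disjoint_union_def snd_conv by blast
qed

lemma simple_finite_disjoint_union: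
  assumes "finite I" "\<And>i. i \<in> I \<Longrightarrow> simple_finite_graph (H i)"
  shows "simple_finite_graph (disjoint_union I H)"
proof -
  have "finite (verts (H i))" "\<And>e. e \<in> edges (H i) \<Longrightarrow> e \<subseteq> verts (H i) \<and> card e = 2"
    if "i \<in> I" for i
    using assms(2)[OF that] by (auto simp: simple_finite_graph_def all_pairs_def)
  with assms(1) show ?thesis
    by (fastforce simp: simple_finite_graph_def disjoint_union_def all_pairs_def
        card_image inj_on_def)
qed

lemma nbrs_disjoint_union:
  "i \<in> I \<Longrightarrow> nbrs (disjoint_union I H) (i, x) = Pair i ` nbrs (H i) x"
  by (auto simp: nbrs_def disjoint_union_edge_iff) (auto simp: disjoint_union_def)

section \<open>Edges, order and regularity of \<open>cycles_union\<close>\<close>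

abbreviation cycle_idx :: "nat \<Rightarrow> (nat \<Rightarrow> nat) \<Rightarrow> (nat \<times> nat) set" where
  "cycle_idx t a \<equiv> SIGMA i:{3..2 * t}. {..<a i}"

lemma cycles_union_verts:
  "verts (cycles_union t a) = (SIGMA p:cycle_idx t a. {..<fst p})"
  by (auto simp: cycles_union_def disjoint_union_def cycle_graph_def)

lemma cycles_union_edge_iff:
  "{(p, x), (q, y)} \<in> edges (cycles_union t a) \<longleftrightarrow>
     p = q \<and> p \<in> cycle_idx t a \<and> {x, y} \<in> edges (cycle_graph (fst p))"
  by (auto simp: cycles_union_def disjoint_union_edge_iff case_prod_beta)

lemma simple_finite_cycles_union: "simple_finite_graph (cycles_union t a)"
  unfolding cycles_union_def
  by (rule simple_finite_disjoint_union) (auto intro: simple_finite_cycle_graph)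

lemma sum_cycle_idx:
  fixes f :: "nat \<Rightarrow> nat"
  shows "(\<Sum>p\<in>cycle_idx t a. f (fst p)) = (\<Sum>i = 3..2 * t. a i * f i)"
proof -
  have "(\<Sum>i = 3..2 * t. a i * f i) = (\<Sum>i = 3..2 * t. \<Sum>j<a i. f i)"
    by simp
  also have "\<dots> = (\<Sum>(i, j)\<in>cycle_idx t a. f i)"
    by (rule sum.Sigma) auto
  finally show ?thesis
    by (simp add: case_prod_beta)
qed

lemma card_verts_cycles_union:
  "card (verts (cycles_union t a)) = (\<Sum>i = 3..2 * t. i * a i)"
proof -
  have "card (verts (cycles_union t a)) = (\<Sum>p\<in>cycle_idx t a. fst p)"
    by (simp add: cycles_union_verts)
  then show ?thesis
    using sum_cycle_idx[of "\<lambda>i. i"] by (simp add: mult.commute)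
qed

lemma regular_cycles_union: "regular 2 (cycles_union t a)"
proof -
  have "card (nbrs (cycles_union t a) (p, x)) = 2" if "p \<in> cycle_idx t a" "x < fst p" for p x
  proof -
    have "nbrs (cycles_union t a) (p, x) = Pair p ` nbrs (cycle_graph (fst p)) x"
      unfolding cycles_union_def using that(1)
      by (simp add: nbrs_disjoint_union case_prod_beta)
    then show ?thesis
      using card_nbrs_cycle_graph[of "fst p" x] that
      by (auto simp: card_image inj_on_def)
  qed
  then show ?thesis
    by (auto simp: regular_def degree_eq_card_nbrs[OF simple_finite_cycles_union]
        cycles_union_verts)
qed

section \<open>The chromatic number of the complement\<close>

text \<open>For \<open>i \<ge> 3\<close> this is the least number of cliques covering the vertices
  of the \<open>i\<close>-cycle: one for a triangle, otherwise half the length rounded up.\<close>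

definition cycle_clique_cover :: "nat \<Rightarrow> nat" where
  "cycle_clique_cover i = (if i = 3 then 1 else (i + 1) div 2)"

lemma chromatic_number_complement_cycles_union_le:
  "chromatic_number (complement (cycles_union t a)) \<le> (\<Sum>i = 3..2 * t. a i * cycle_clique_cover i)"
proof -
  let ?G = "cycles_union t a"
  \<comment> \<open>The first entry keeps the colours of different components apart. Within a longer
    cycle \<open>x div 2\<close> groups the consecutive vertices \<open>2k\<close> and
    \<open>2k + 1\<close>, leaving the last vertex alone when the length is odd.\<close>
  let ?c = "\<lambda>(p :: nat \<times> nat, x :: nat). (p, if fst p = 3 then 0 else x div 2)"
  have fin: "finite (verts ?G)"
    using simple_finite_cycles_union by (auto simp: simple_finite_graph_def)
  have "chromatic_number (complement ?G) \<le> card (?c ` verts (complement ?G))"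
  proof (rule chromatic_number_le_card_image)
    show "finite (verts (complement ?G))"
      using fin by simp
    fix u v assume uv: "{u, v} \<in> edges (complement ?G)"
    obtain p x q y where [simp]: "u = (p, x)" "v = (q, y)"
      by fastforce
    have mem: "p \<in> cycle_idx t a" "x < fst p" "y < fst q" and ne: "(p, x) \<noteq> (q, y)"
      and nadj: "p = q \<Longrightarrow> {x, y} \<notin> edges (cycle_graph (fst p))"
      using uv by (auto simp: edge_complement_iff cycles_union_verts cycles_union_edge_iff)
    show "?c u \<noteq> ?c v"
    proof
      assume eq: "?c u = ?c v"
      then have [simp]: "q = p"
        by simp
      have xy: "x < fst p" "y < fst p" "x \<noteq> y"
        using mem ne by auto
      show False
      proof (cases "fst p = 3")
        case True
        with xy nadj show False
          by (simp add: cycle_graph_edge_iff) arith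
      next
        case False
        with eq have "x div 2 = y div 2"
          by simp
        with xy have "Suc x = y \<or> Suc y = x"
          by arith
        with xy nadj show False
          by (auto simp: cycle_graph_edge_iff)
      qed
    qed
  qed
  also have "\<dots> \<le> card (SIGMA p:cycle_idx t a. {..<cycle_clique_cover (fst p)})"
    by (rule card_mono) (auto simp: cycles_union_verts cycle_clique_cover_def)
  also have "\<dots> = (\<Sum>i = 3..2 * t. a i * cycle_clique_cover i)"
    by (simp add: sum_cycle_idx)
  finally show ?thesis .
qed

text \<open>The colours used on each component are counted separately: a colour class is a clique of
  the original graph, so it stays inside one cycle and, off the triangles, has at most two
  vertices.\<close>

lemma chromatic_number_complement_cycles_union_ge:
  "(\<Sum>i = 3..2 * t. a i * cycle_clique_cover i) \<le> chromatic_number (complement (cycles_union t a))"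
proof -
  let ?G = "cycles_union t a"
  let ?I = "cycle_idx t a"
  let ?k = "chromatic_number (complement ?G)"
  have fin: "finite (verts ?G)"
    using simple_finite_cycles_union by (auto simp: simple_finite_graph_def)
  obtain c where c: "proper_colouring (complement ?G) ?k c"
    using chromatic_number_attained[OF simple_finite_graph_complement[OF fin]] .
  \<comment> \<open>Equally coloured vertices are non-adjacent in the complement, hence adjacent in
    a common cycle.\<close>
  have same: "p = q \<and> {x, y} \<in> edges (cycle_graph (fst p))"
    if "p \<in> ?I" "q \<in> ?I" "x < fst p" "y < fst q" "(p, x) \<noteq> (q, y)" "c (p, x) = c (q, y)"
    for p q x y
  proof -
    have "(p, x) \<in> verts ?G" "(q, y) \<in> verts ?G"
      using that by (auto simp: cycles_union_verts)
    then have "{(p, x), (q, y)} \<in> edges ?G"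
      using c that(5,6) unfolding proper_colouring_def verts_complement edge_complement_iff
      by blast
    then show ?thesis
      unfolding cycles_union_edge_iff by blast
  qed
  let ?C = "\<lambda>p. (\<lambda>x. c (p, x)) ` {..<fst p}"
  have lower: "cycle_clique_cover (fst p) \<le> card (?C p)" if p: "p \<in> ?I" for p
  proof (cases "fst p = 3")
    case True
    then have "?C p \<noteq> {}"
      by (simp add: lessThan_empty_iff)
    then have "card (?C p) > 0"
      by (simp add: card_gt_0_iff)
    with True show ?thesis
      by (simp add: cycle_clique_cover_def)
  next
    case False
    then have "fst p \<ge> 4"
      using p by auto
    then have "card {x \<in> {..<fst p}. c (p, x) = b} \<le> 2" for b
      using same[OF p p] by (intro card_clique_cycle_graph[of "fst p"]) auto
    then have "card {..<fst p} \<le> 2 * card (?C p)"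
      by (intro card_le_mult_card_image) auto
    with False show ?thesis
      by (simp add: cycle_clique_cover_def)
  qed
  have "(\<Sum>i = 3..2 * t. a i * cycle_clique_cover i) = (\<Sum>p\<in>?I. cycle_clique_cover (fst p))"
    by (simp add: sum_cycle_idx)
  also have "\<dots> \<le> (\<Sum>p\<in>?I. card (?C p))"
    by (rule sum_mono) (rule lower)
  \<comment> \<open>By \<open>same\<close>, distinct components use disjoint sets of colours, so the
    counts add up.\<close>
  also have "\<dots> = card (\<Union>p\<in>?I. ?C p)"
  proof (rule card_UN_disjoint[symmetric])
    show "\<forall>p\<in>?I. \<forall>q\<in>?I. p \<noteq> q \<longrightarrow> ?C p \<inter> ?C q = {}"
      using same by blast
  qed auto
  also have "\<dots> \<le> card {..<?k}"
    using c by (intro card_mono) (auto simp: proper_colouring_def cycles_union_verts)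
  finally show ?thesis
    by simp
qed

text \<open>After doubling, an even cycle contributes its length, an odd cycle of length at least 5
  one more, and a triangle one less. The triangle deficit \<open>a 3\<close> stands on the left to
  avoid subtraction on \<open>nat\<close>.\<close>

lemma chromatic_number_complement_cycles_union:
  assumes "t \<ge> 2"
  shows "2 * chromatic_number (complement (cycles_union t a)) + a 3 =
    (\<Sum>i = 3..2 * t. i * a i) + (\<Sum>i | i \<in> {5..2 * t - 1} \<and> odd i. a i)"
proof -
  have cover: "2 * (a i * cycle_clique_cover i) + (if i = 3 then a i else 0) =
      i * a i + (if 5 \<le> i \<and> odd i then a i else 0)" if "i \<ge> 3" for i
  proof -
    have "2 * cycle_clique_cover i + (if i = 3 then 1 else 0) =
        i + (if 5 \<le> i \<and> odd i then 1 else 0)"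
    proof (cases "i < 5")
      case True
      with that have "i = 3 \<or> i = 4"
        by auto
      then show ?thesis
        by (auto simp: cycle_clique_cover_def)
    next
      case False
      then show ?thesis
        unfolding cycle_clique_cover_def by (cases "even i") (auto elim!: oddE evenE)
    qed
    then have "a i * (2 * cycle_clique_cover i + (if i = 3 then 1 else 0)) =
        a i * (i + (if 5 \<le> i \<and> odd i then 1 else 0))"
      by simp
    then show ?thesis
      by (auto simp: algebra_simps split: if_splits)
  qed
  \<comment> \<open>The upper limits agree because \<open>2 * t\<close> is even.\<close>
  have "{i. i \<in> {5..2 * t - 1} \<and> odd i} = {i \<in> {3..2 * t}. 5 \<le> i \<and> odd i}"
  proof (intro Collect_cong iffI)
    fix i assume i: "i \<in> {3..2 * t} \<and> 5 \<le> i \<and> odd i"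
    then have "i \<noteq> 2 * t"
      by auto
    with i show "i \<in> {5..2 * t - 1} \<and> odd i"
      by auto
  qed auto
  then have odd_sum: "(\<Sum>i | i \<in> {5..2 * t - 1} \<and> odd i. a i) =
      (\<Sum>i = 3..2 * t. if 5 \<le> i \<and> odd i then a i else 0)"
    by (simp only: sum.inter_filter finite_atLeastAtMost)
  \<comment> \<open>Since \<open>t \<ge> 2\<close>, the index 3 lies in the range and
    \<open>a 3\<close> can be absorbed into the sum.\<close>
  have "2 * (\<Sum>i = 3..2 * t. a i * cycle_clique_cover i) + a 3 =
      (\<Sum>i = 3..2 * t. 2 * (a i * cycle_clique_cover i) + (if i = 3 then a i else 0))"
    using assms by (simp add: sum.distrib sum_distrib_left)
  also have "\<dots> = (\<Sum>i = 3..2 * t. i * a i + (if 5 \<le> i \<and> odd i then a i else 0))"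
    by (rule sum.cong) (use cover in auto)
  finally show ?thesis
    using chromatic_number_complement_cycles_union_le[of t a]
      chromatic_number_complement_cycles_union_ge[of a t] odd_sum
    by (simp add: sum.distrib)
qed

section \<open>Exclusion of competing graphs of smaller order\<close>

lemma r_chi_graph_order_ge:
  assumes H: "r_chi_graph (n - 3) \<chi> H" and n: "n \<ge> 6" and \<chi>: "\<chi> = (n + 1) div 2"
  shows "n \<le> card (verts H)"
proof (rule ccontr)
  assume less: "\<not> n \<le> card (verts H)"
  have simple: "simple_finite_graph H" and reg: "regular (n - 3) H"
    and chi: "chromatic_number H = \<chi>"
    using H by (auto simp: r_chi_graph_def)
  \<comment> \<open>The empty graph is regular of every degree, so only its chromatic number 0 rules
    it out.\<close>
  have "verts H \<noteq> {}"
  proof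
    assume "verts H = {}"
    then have "chromatic_number H \<le> 0"
      using chromatic_number_le_card_image[of H id] by simp
    with chi \<chi> n show False
      by simp
  qed
  then have "n - 3 < card (verts H)"
    by (rule regular_less_card[OF simple reg])
  with less consider "card (verts H) = (n - 3) + 1" | "card (verts H) = (n - 3) + 2"
    by linarith
  then show False
  proof cases
    case 1
    \<comment> \<open>Completeness would give \<open>n - 2 \<le> (n + 1) div 2\<close>, which fails
      from \<open>n = 6\<close> on but still holds for \<open>n = 5\<close>.\<close>
    from card_le_chromatic_number_complete[OF simple reg 1] 1 chi \<chi> n show False
      by simp
  next
    case 2
    \<comment> \<open>Here \<open>n - 1\<close> is even, so \<open>2 * \<chi> = n + 1\<close>,
      against the bound \<open>2 * \<chi> \<le> n - 1\<close>.\<close>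
    from cocktail_party[OF simple reg 2] 2 chi \<chi> n show False
      by presburger
  qed
qed

theorem theorem5:
  fixes t n :: nat and a :: "nat \<Rightarrow> nat" and G :: "((nat \<times> nat) \<times> nat) ugraph"
  assumes "t \<ge> 2"
    and "G = cycles_union t a"
    and "n = (\<Sum>i = 3..2 * t. i * a i)"
    and "n \<ge> 6"
  shows "(even n \<and> (\<Sum>i | i \<in> {5..2 * t - 1} \<and> odd i. a i) = a 3 \<longrightarrow>
            extremal_r_chi_graph (n - 3) (chromatic_number (complement G)) (complement G)) \<and>
         (odd n \<and> (\<Sum>i | i \<in> {5..2 * t - 1} \<and> odd i. a i) = a 3 + 1 \<longrightarrow>
            extremal_r_chi_graph (n - 3) (chromatic_number (complement G)) (complement G))"
proof -
  let ?\<chi> = "chromatic_number (complement G)"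
  have simple: "simple_finite_graph G" and reg: "regular 2 G" and card: "card (verts G) = n"
    using assms simple_finite_cycles_union regular_cycles_union card_verts_cycles_union by auto
  have chi: "2 * ?\<chi> + a 3 = n + (\<Sum>i | i \<in> {5..2 * t - 1} \<and> odd i. a i)"
    using chromatic_number_complement_cycles_union[OF assms(1)] assms(2,3) by simp
  have "r_chi_graph (n - 3) ?\<chi> (complement G)"
    using simple reg card
    by (simp add: r_chi_graph_def regular_def degree_complement simple_finite_graph_complement
        simple_finite_graph_def[of G] numeral_3_eq_3)
  then have "extremal_r_chi_graph (n - 3) ?\<chi> (complement G)" if "?\<chi> = (n + 1) div 2"
    unfolding extremal_r_chi_graph_def verts_complement card
    using r_chi_graph_order_ge[OF _ assms(4) that] by blast
  \<comment> \<open>Cancelling \<open>a 3\<close> in \<open>chi\<close> leaves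
    \<open>2 * ?\<chi> = n\<close> in the even case and \<open>n + 1\<close> in the odd one.\<close>
  moreover have "?\<chi> = (n + 1) div 2"
    if "even n" "(\<Sum>i | i \<in> {5..2 * t - 1} \<and> odd i. a i) = a 3"
    using chi that by simp
  moreover have "?\<chi> = (n + 1) div 2"
    if "odd n" "(\<Sum>i | i \<in> {5..2 * t - 1} \<and> odd i. a i) = a 3 + 1"
    using chi that by simp
  ultimately show ?thesis
    by blast
qed

end
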